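(* Any finite group is a direct factor of (and so in particular embeds into) some finite non-RCC-group.
   Context: A permutation of a finite set satisfies the regular cycle condition (RCC) if it has a cycle whose length equals its order. A finite group is an RCC-group if every automorphism of it, viewed as a permutation of its underlying set, satisfies the RCC; otherwise it is a non-RCC-group. *)

theory Defs
  imports
    "HOL-Algebra.Bij"
    "HOL-Algebra.Multiplicative_Group"
    "HOL-Combinatorics.Orbits"
begin

text \<open>
  For a permutation \<open>f\<close> of a finite set \<open>S\<close> (an element of \<^const>\<open>Bij\<close>), the cycle of \<open>f\<close> through
  \<open>x \<in> S\<close> is \<^term>\<open>orbit f x\<close>, so fixed points are cycles of length 1. The order of \<open>f\<close> is its order
  as an element of the symmetric group on \<open>S\<close>.
\<close>

definition regular_cycle_condition :: "'a set \<Rightarrow> ('a \<Rightarrow> 'a) \<Rightarrow> bool" where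
  "regular_cycle_condition S f \<longleftrightarrow>
     (\<exists>x\<in>S. card (orbit f x) = group.ord (BijGroup S) f)"

definition RCC_group :: "('a, 'm) monoid_scheme \<Rightarrow> bool" where
  "RCC_group G \<longleftrightarrow> group G \<and> finite (carrier G) \<and>
     (\<forall>f\<in>auto G. regular_cycle_condition (carrier G) f)"

definition non_RCC_group :: "('a, 'm) monoid_scheme \<Rightarrow> bool" where
  "non_RCC_group G \<longleftrightarrow> group G \<and> finite (carrier G) \<and> \<not> RCC_group G"

text \<open>
  The complement \<open>K\<close> is isomorphic to a subgroup of \<open>H\<close>, so taking it over the element type of \<open>H\<close>
  loses no generality.
\<close>

definition direct_factor :: "('a, 'm) monoid_scheme \<Rightarrow> ('b, 'n) monoid_scheme \<Rightarrow> bool" where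
  "direct_factor G H \<longleftrightarrow> group G \<and> group H \<and> (\<exists>K :: 'b monoid. group K \<and> H \<cong> G \<times>\<times> K)"

end

theory Submission
  imports Defs "HOL-Algebra.Weak_Morphisms" "HOL-Library.Numeral_Type"
begin

text \<open>
  Let \<open>K = D\<^sub>3 \<times> D\<^sub>5 \<times> C\<^sub>2\<close> with dihedral factors of orders 6 and 10, and let \<open>s\<close>, \<open>t\<close> be
  the homomorphisms from \<open>K\<close> onto \<open>C\<^sub>2\<close> that detect reflections in the first and in the second
  factor. The automorphism that multiplies by \<open>(r\<^sub>3\<^sup>s, r\<^sub>5\<^sup>t, z\<^sup>s\<^sup>+\<^sup>t)\<close>, with generating rotations
  \<open>r\<^sub>3\<close>, \<open>r\<^sub>5\<close> and \<open>z\<close> generating \<open>C\<^sub>2\<close>, has order 30, but on each element one of \<open>s\<close>, \<open>t\<close>,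
  \<open>s + t\<close> vanishes, so that every cycle length divides 10, 6 or 15. Extending this automorphism by
  the identity on \<open>G\<close> gives an automorphism of \<open>G \<times> K\<close> without a regular cycle.
\<close>

text \<open>
  The length of the cycle through \<open>x\<close> divides the exponent \<open>k\<close>, whereas the order of \<open>f\<close> does not.
\<close>

definition irregular_automorphism :: "('a, 'm) monoid_scheme \<Rightarrow> ('a \<Rightarrow> 'a) \<Rightarrow> bool" where
  "irregular_automorphism G f \<longleftrightarrow> f \<in> iso G G \<and>
     (\<forall>x\<in>carrier G. \<exists>k>0. (f ^^ k) x = x \<and> (\<exists>y\<in>carrier G. (f ^^ k) y \<noteq> y))"

section \<open>Iterates and cycle lengths\<close>

lemma funpow_closed:
  assumes "f ` S \<subseteq> S" "x \<in> S"
  shows "(f ^^ k) x \<in> S"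
  using assms by (induction k) auto

text \<open>Used with \<open>h = id\<close>, to compare a map with its restriction to the carrier,
  and with \<open>h\<close> an isomorphism, to follow iterates of a conjugate.\<close>

lemma funpow_semiconj:
  assumes "\<And>x. x \<in> S \<Longrightarrow> g (h x) = h (f x)" "f ` S \<subseteq> S" "x \<in> S"
  shows "(g ^^ k) (h x) = h ((f ^^ k) x)"
  using assms by (induction k) (simp_all add: funpow_closed)

text \<open>The orbit has as many points as the least positive period \<open>n\<close>;
  \<open>k mod n\<close> also returns \<open>x\<close> to itself, so minimality forces it to be
  0.\<close>

lemma card_orbit_dvd:
  assumes "(f ^^ k) x = x" "0 < k"
  shows "card (orbit f x) dvd k"
proof -
  define n where "n = (LEAST m. 0 < m \<and> (f ^^ m) x = x)"
  have n: "0 < n" "(f ^^ n) x = x"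
    unfolding n_def using LeastI[of "\<lambda>m. 0 < m \<and> (f ^^ m) x = x" k] assms by auto
  have least: "n \<le> m" if "0 < m" "(f ^^ m) x = x" for m
    unfolding n_def using that by (intro Least_le) simp
  have inj: "inj_on (\<lambda>m. (f ^^ m) x) {..<n}"
  proof (rule linorder_inj_onI)
    fix i j assume ij: "i < j" "i \<in> {..<n}" "j \<in> {..<n}"
    show "(f ^^ i) x \<noteq> (f ^^ j) x"
    proof
      assume eq: "(f ^^ i) x = (f ^^ j) x"
      \<comment> \<open>Applying \<open>f ^^ (n - j)\<close> to both sides of the coincidence yields
        the period \<open>n - j + i\<close>, which is positive but below \<open>n\<close>.\<close>
      have "(f ^^ (n - j + i)) x = (f ^^ (n - j)) ((f ^^ i) x)"
        by (simp add: funpow_add)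
      also have "\<dots> = (f ^^ (n - j + j)) x"
        unfolding eq by (simp add: funpow_add)
      also have "\<dots> = x"
        using ij n by simp
      finally have "n \<le> n - j + i"
        using ij by (intro least) auto
      then show False
        using ij by auto
    qed
  qed auto
  have "orbit f x = (\<lambda>m. (f ^^ m) x) ` {..<n}"
    using orbit_altdef_bounded[OF n(2,1)] by auto
  then have card: "card (orbit f x) = n"
    by (simp add: card_image inj)
  have "(f ^^ (k mod n)) x = x"
    using funpow_mod_eq[OF n(2), of k] assms by simp
  then have "k mod n = 0"
    using least[of "k mod n"] n(1) by (meson mod_less_divisor not_gr_zero not_le)
  with card show ?thesis
    by auto
qed

section \<open>Powers and orders in the symmetric group\<close>

lemma carrier_BijGroup: "carrier (BijGroup S) = Bij S"
  by (simp add: BijGroup_def)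

lemma one_BijGroup_apply: "x \<in> S \<Longrightarrow> \<one>\<^bsub>BijGroup S\<^esub> x = x"
  by (simp add: BijGroup_def)

lemma mult_BijGroup_apply:
  "\<lbrakk>f \<in> Bij S; g \<in> Bij S; x \<in> S\<rbrakk> \<Longrightarrow> (f \<otimes>\<^bsub>BijGroup S\<^esub> g) x = f (g x)"
  by (simp add: BijGroup_def compose_def)

text \<open>Elements of \<open>BijGroup S\<close> are extensional while iterates are taken on the
  whole type, so the two are compared pointwise on \<open>S\<close>.\<close>

lemma BijGroup_pow:
  assumes "f \<in> Bij S" "x \<in> S"
  shows "(f [^]\<^bsub>BijGroup S\<^esub> (k::nat)) x = (f ^^ k) x"
  using assms(2)
proof (induction k arbitrary: x)
  case 0
  then show ?case
    by (simp only: group.is_monoid[OF group_BijGroup] monoid.nat_pow_0 one_BijGroup_apply funpow_0)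
next
  case (Suc k)
  have "f [^]\<^bsub>BijGroup S\<^esub> k \<in> Bij S"
    using monoid.nat_pow_closed[OF group.is_monoid[OF group_BijGroup], of f S k] assms(1)
    unfolding carrier_BijGroup .
  moreover have "f x \<in> S"
    using Suc.prems Bij_imp_funcset[OF assms(1)] by (rule funcset_mem[rotated])
  ultimately show ?case
    unfolding monoid.nat_pow_Suc[OF group.is_monoid[OF group_BijGroup]]
    using assms(1) Suc.prems
    by (simp only: mult_BijGroup_apply Suc.IH funpow_Suc_right o_apply)
qed

lemma ord_BijGroup_dvd:
  assumes "f \<in> Bij S" "group.ord (BijGroup S) f dvd k" "x \<in> S"
  shows "(f ^^ k) x = x"
proof -
  have "f [^]\<^bsub>BijGroup S\<^esub> k = \<one>\<^bsub>BijGroup S\<^esub>"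
    using group.pow_eq_id[OF group_BijGroup, of f S k] assms(1,2)
    unfolding carrier_BijGroup by blast
  then show ?thesis
    using BijGroup_pow[OF assms(1,3), of k] one_BijGroup_apply[OF assms(3)] by metis
qed

text \<open>If the cycle through \<open>x\<close> had length equal to the order, the order would
  divide the exponent \<open>k\<close> chosen for \<open>x\<close>, and the \<open>k\<close>-th
  iterate would fix every element, including \<open>y\<close>.\<close>

lemma irregular_automorphism_imp_non_RCC:
  assumes "group G" "finite (carrier G)" "irregular_automorphism G f"
  shows "non_RCC_group G"
proof -
  \<comment> \<open>Members of \<open>auto G\<close> must be extensional, which \<open>f\<close>
    need not be.\<close>
  define f' where "f' = restrict f (carrier G)"
  have f: "f \<in> hom G G" "bij_betw f (carrier G) (carrier G)"
    using assms(3) by (auto simp: irregular_automorphism_def iso_def)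
  have bij: "f' \<in> Bij (carrier G)"
    using f(2) by (simp add: Bij_def f'_def bij_betw_restrict_eq)
  interpret group G by fact
  have "f' \<in> hom G G"
    using f(1) by (auto simp: hom_def f'_def)
  with bij have auto: "f' \<in> auto G"
    by (simp add: auto_def)
  have pow: "(f' ^^ k) x = (f ^^ k) x" if "x \<in> carrier G" for x k
    using funpow_semiconj[of "carrier G" f' id f x k] f(2) that
    by (auto simp: f'_def bij_betw_def)
  have "\<not> regular_cycle_condition (carrier G) f'"
  proof
    assume "regular_cycle_condition (carrier G) f'"
    then obtain x where x: "x \<in> carrier G"
        "card (orbit f' x) = group.ord (BijGroup (carrier G)) f'"
      by (auto simp: regular_cycle_condition_def)
    then obtain k y where k: "0 < k" "(f ^^ k) x = x" "y \<in> carrier G" "(f ^^ k) y \<noteq> y"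
      using assms(3) unfolding irregular_automorphism_def by blast
    have "group.ord (BijGroup (carrier G)) f' dvd k"
      using card_orbit_dvd[of k f' x] k x by (simp add: pow)
    then show False
      using ord_BijGroup_dvd[OF bij _ k(3)] k pow by auto
  qed
  then show ?thesis
    using assms auto by (auto simp: non_RCC_group_def RCC_group_def)
qed

text \<open>Conjugation by \<open>h\<close> carries both the fixed point and the moved point of each
  iterate to \<open>H\<close>.\<close>

lemma irregular_automorphism_transport:
  assumes "group G" "h \<in> iso G H" "irregular_automorphism G f"
  shows "\<exists>g. irregular_automorphism H g"
proof -
  interpret group G by fact
  let ?h' = "inv_into (carrier G) h"
  define g where "g = h \<circ> f \<circ> ?h'"
  have f: "f \<in> iso G G" "f ` carrier G \<subseteq> carrier G"
    using assms(3) by (auto simp: irregular_automorphism_def iso_def bij_betw_def)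
  have h: "inj_on h (carrier G)" "h ` carrier G = carrier H"
    using assms(2) by (auto simp: iso_def bij_betw_def)
  have "g \<in> iso H H"
    unfolding g_def comp_assoc
    by (rule iso_set_trans[OF iso_set_trans[OF iso_set_sym[OF assms(2)] f(1)] assms(2)])
  moreover have pow: "(g ^^ k) (h x) = h ((f ^^ k) x)" if "x \<in> carrier G" for x k
    using that f(2) h by (intro funpow_semiconj) (auto simp: g_def)
  have "\<exists>k>0. (g ^^ k) z = z \<and> (\<exists>y\<in>carrier H. (g ^^ k) y \<noteq> y)" if "z \<in> carrier H" for z
  proof -
    obtain x where x: "x \<in> carrier G" "z = h x"
      using \<open>z \<in> carrier H\<close> h(2) by blast
    then obtain k y where k: "0 < k" "(f ^^ k) x = x" "y \<in> carrier G" "(f ^^ k) y \<noteq> y"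
      using assms(3) unfolding irregular_automorphism_def by blast
    then have "h ((f ^^ k) y) \<noteq> h y"
      using h(1) funpow_closed[OF f(2)] by (auto dest: inj_onD)
    then show ?thesis
      using k(1-3) x pow h(2) by (intro exI[of _ k]) (auto intro!: bexI[of _ "h y"])
  qed
  ultimately show ?thesis
    unfolding irregular_automorphism_def by blast
qed

text \<open>The exponent for \<open>(u, v)\<close> is the one for \<open>v\<close>; the moved
  element \<open>y\<close> is paired with the identity of \<open>G\<close>.\<close>

lemma irregular_automorphism_DirProd:
  fixes G :: "('a, 'm) monoid_scheme"
  assumes "group G" "irregular_automorphism K f"
  shows "irregular_automorphism (G \<times>\<times> K) (map_prod id f)"
proof -
  interpret group G by fact
  have "(\<lambda>x. x) \<in> iso G G"
    by (rule iso_set_refl)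
  then have "(\<lambda>(x, y). (x, f y)) \<in> iso (G \<times>\<times> K) (G \<times>\<times> K)"
    using assms(2) by (intro DirProd_iso_set_trans) (auto simp: irregular_automorphism_def)
  then have "map_prod id f \<in> iso (G \<times>\<times> K) (G \<times>\<times> K)"
    by (simp add: map_prod_def)
  moreover have "\<exists>k>0. (map_prod id f ^^ k) z = z \<and>
      (\<exists>y\<in>carrier (G \<times>\<times> K). (map_prod id f ^^ k) y \<noteq> y)"
    if "z \<in> carrier (G \<times>\<times> K)" for z
  proof -
    have pow: "(map_prod id f ^^ k) (u, v) = (u, (f ^^ k) v)" for k and u :: 'a and v
      by (induction k) auto
    obtain u v where z: "z = (u, v)" "v \<in> carrier K"
      using \<open>z \<in> carrier (G \<times>\<times> K)\<close> by auto
    then obtain k y where k: "0 < k" "(f ^^ k) v = v" "y \<in> carrier K" "(f ^^ k) y \<noteq> y"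
      using assms(2) unfolding irregular_automorphism_def by blast
    have "(\<one>\<^bsub>G\<^esub>, y) \<in> carrier (G \<times>\<times> K)"
      using k(3) by simp
    moreover have "(map_prod id f ^^ k) (\<one>\<^bsub>G\<^esub>, y) \<noteq> (\<one>\<^bsub>G\<^esub>, y)"
      unfolding pow using k(4) by simp
    moreover have "(map_prod id f ^^ k) z = z"
      unfolding z pow using k(2) by simp
    ultimately show ?thesis
      using k(1) by blast
  qed
  ultimately show ?thesis
    unfolding irregular_automorphism_def by blast
qed

section \<open>The witness group and its automorphism\<close>

text \<open>
  In \<open>(a, b, c, s, t)\<close> the pairs \<open>(a, s)\<close> and \<open>(b, t)\<close> are the dihedral components, with \<open>s\<close>
  and \<open>t\<close> marking reflections, and \<open>c\<close> is the central component.
\<close>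

definition witness_group :: "(3 \<times> 5 \<times> 2 \<times> bool \<times> bool) monoid" where
  "witness_group =
     \<lparr>carrier = UNIV,
      monoid.mult = (\<lambda>(a, b, c, s, t) (a', b', c', s', t').
        (a + (if s then - a' else a'), b + (if t then - b' else b'), c + c', s \<noteq> s', t \<noteq> t')),
      one = (0, 0, 0, False, False)\<rparr>"

definition witness_automorphism ::
    "3 \<times> 5 \<times> 2 \<times> bool \<times> bool \<Rightarrow> 3 \<times> 5 \<times> 2 \<times> bool \<times> bool" where
  "witness_automorphism =
     (\<lambda>(a, b, c, s, t). (a + of_bool s, b + of_bool t, c + of_bool (s \<noteq> t), s, t))"

lemma witness_automorphism_pow:
  "(witness_automorphism ^^ k) (a, b, c, s, t) =
     (a + of_nat k * of_bool s, b + of_nat k * of_bool t, c + of_nat k * of_bool (s \<noteq> t), s, t)"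
  by (induction k) (auto simp: witness_automorphism_def algebra_simps)

lemma group_witness_group: "group witness_group"
proof (rule groupI)
  fix x assume "x \<in> carrier witness_group"
  obtain a b c s t where x: "x = (a, b, c, s, t)"
    by (cases x)
  show "\<exists>y\<in>carrier witness_group. y \<otimes>\<^bsub>witness_group\<^esub> x = \<one>\<^bsub>witness_group\<^esub>"
    by (rule bexI[of _ "(if s then a else - a, if t then b else - b, - c, s, t)"])
      (auto simp: x witness_group_def)
qed (auto simp: witness_group_def)

lemma irregular_witness_automorphism:
  "irregular_automorphism witness_group witness_automorphism"
proof -
  \<comment> \<open>The shift by \<open>of_bool s\<close> is a crossed homomorphism for the sign
    action; this makes the map multiplicative in both dihedral components.\<close>
  have twisted: "of_bool (s \<noteq> s') + (if s then - x else x) = of_bool s + (if s then - (x + of_bool s') else x + of_bool s')"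
    for s s' :: bool and x :: "'a::comm_ring_1"
    by (cases s; cases s'; simp)
  have parity: "of_bool ((s \<noteq> s') \<noteq> (t \<noteq> t')) = (of_bool (s \<noteq> t) + of_bool (s' \<noteq> t') :: 2)"
    for s s' t t' :: bool
    by (cases s; cases s'; cases t; cases t'; simp)
  have "witness_automorphism \<in> hom witness_group witness_group"
  proof (rule homI)
    fix x y :: "3 \<times> 5 \<times> 2 \<times> bool \<times> bool"
    obtain a b c s t a' b' c' s' t' where xy: "x = (a, b, c, s, t)" "y = (a', b', c', s', t')"
      by (cases x, cases y)
    show "witness_automorphism (x \<otimes>\<^bsub>witness_group\<^esub> y) =
        witness_automorphism x \<otimes>\<^bsub>witness_group\<^esub> witness_automorphism y"
      using twisted[of s s' a'] twisted[of t t' b'] parity[of s s' t t']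
      unfolding xy witness_group_def witness_automorphism_def
      by (simp only: monoid.simps prod.case prod.inject add.assoc add.left_commute add.commute simp_thms)
  qed (simp add: witness_group_def)
  moreover have "inj witness_automorphism"
    by (auto simp: inj_on_def witness_automorphism_def)
  then have "bij witness_automorphism"
    by (simp add: bij_def finite_UNIV_inj_surj)
  ultimately have "witness_automorphism \<in> iso witness_group witness_group"
    by (simp add: iso_def witness_group_def)
  moreover have "\<exists>k>0. (witness_automorphism ^^ k) x = x \<and>
      (\<exists>y. (witness_automorphism ^^ k) y \<noteq> y)" for x
  proof -
    obtain a b c s t where x: "x = (a, b, c, s, t)"
      by (cases x)
    \<comment> \<open>In each case one of the first three coordinates is fixed, and the exponent is
      the product of the moduli of the other two. It is 1 modulo the omitted modulus, so it moves
      any element whose corresponding shift is nonzero.\<close>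
    consider "\<not> s" | "\<not> t" | "s" "t"
      by blast
    then show ?thesis
    proof cases
      case 1
      have "(witness_automorphism ^^ 10) (0, 0, 0, True, True) \<noteq> (0, 0, 0, True, True)"
        by (simp add: witness_automorphism_pow)
      with 1 show ?thesis
        by (intro exI[of _ 10]) (auto simp: x witness_automorphism_pow)
    next
      case 2
      have "(witness_automorphism ^^ 6) (0, 0, 0, True, True) \<noteq> (0, 0, 0, True, True)"
        by (simp add: witness_automorphism_pow)
      with 2 show ?thesis
        by (intro exI[of _ 6]) (auto simp: x witness_automorphism_pow)
    next
      case 3
      have "(witness_automorphism ^^ 15) (0, 0, 0, True, False) \<noteq> (0, 0, 0, True, False)"
        by (simp add: witness_automorphism_pow)
      with 3 show ?thesis
        by (intro exI[of _ 15]) (auto simp: x witness_automorphism_pow)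
    qed
  qed
  ultimately show ?thesis
    by (simp add: irregular_automorphism_def witness_group_def)
qed

text \<open>The group structure is carried along any injection of the carrier into
  \<open>nat\<close>.\<close>

lemma finite_group_iso_nat:
  assumes "group G" "finite (carrier G)"
  obtains H :: "nat monoid" and h where "group H" "h \<in> iso G H"
proof -
  interpret group G by fact
  obtain h :: "'a \<Rightarrow> nat" where "inj_on h (carrier G)"
    using finite_imp_inj_to_nat_seg[OF assms(2)] by blast
  then show ?thesis
    using that inj_imp_image_group_iso inj_imp_image_group_is_group by blast
qed

theorem proposition5p1:
  fixes G :: "('a, 'm) monoid_scheme"
  assumes "group G" and "finite (carrier G)"
  shows "\<exists>H :: nat monoid. non_RCC_group H \<and> direct_factor G H \<and> mon G H \<noteq> {}"
proof -
  have "finite (carrier witness_group)"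
    by simp
  \<comment> \<open>The complement is copied to \<open>nat\<close> because
    \<open>direct_factor\<close> requires it over the element type of \<open>H\<close>.\<close>
  then obtain K :: "nat monoid" and k where K: "group K" "k \<in> iso witness_group K"
    using finite_group_iso_nat[OF group_witness_group] by blast
  have finK: "finite (carrier K)"
    using iso_finite[OF is_isoI[OF K(2)]] by simp
  obtain g where "irregular_automorphism K g"
    using irregular_automorphism_transport[OF group_witness_group K(2)]
      irregular_witness_automorphism by blast
  then have irr: "irregular_automorphism (G \<times>\<times> K) (map_prod id g)"
    by (rule irregular_automorphism_DirProd[OF assms(1)])
  have GK: "group (G \<times>\<times> K)" "finite (carrier (G \<times>\<times> K))"
    using assms K(1) finK by (simp_all add: DirProd_group)
  then obtain H :: "nat monoid" and h where H: "group H" "h \<in> iso (G \<times>\<times> K) H"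
    using finite_group_iso_nat by blast
  have "finite (carrier H)"
    using iso_finite[OF is_isoI[OF H(2)]] GK(2) by simp
  moreover obtain f where "irregular_automorphism H f"
    using irregular_automorphism_transport[OF GK(1) H(2) irr] by blast
  ultimately have "non_RCC_group H"
    using irregular_automorphism_imp_non_RCC H(1) by blast
  moreover have "H \<cong> G \<times>\<times> K"
    using group.iso_set_sym[OF GK(1) H(2)] by (rule is_isoI)
  then have "direct_factor G H"
    using assms(1) H(1) K(1) by (auto simp: direct_factor_def)
  moreover have "h \<circ> (\<lambda>x. (x, \<one>\<^bsub>K\<^esub>)) \<in> mon G H"
  proof (rule mon_compose)
    show "(\<lambda>x. (x, \<one>\<^bsub>K\<^esub>)) \<in> mon G (G \<times>\<times> K)"
      using K(1) by (auto simp: mon_def hom_def inj_on_def group.is_monoid)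
    show "h \<in> mon (G \<times>\<times> K) H"
      using H(2) by (simp add: iso_iff_mon_epi)
  qed
  ultimately show ?thesis
    by blast
qed

end
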